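(* Let $\frac12+i\xi$ ($\xi$ real) be a zero of $\zeta(s)$ of multiplicity $\omega$ on the critical line. Then $$\kappa'(\xi)=\frac{1}{\pi\omega}\vartheta'(\xi).$$
   Context: $\zeta$ is Riemann's zeta function; $\vartheta\colon\mathbf{R}\to\mathbf{R}$ is the Riemann–Siegel theta function, i.e. the real analytic function with $\vartheta(0)=0$ and $\Gamma(\frac14+\frac{it}{2})=|\Gamma(\frac14+\frac{it}{2})|\,e^{i(\vartheta(t)+\frac t2\log\pi)}$. The function $\kappa\colon\mathbf{R}\to\mathbf{R}$ is the unique real analytic function with $\kappa(0)=-\frac12$ and $e^{2\pi i\kappa(t)}=1+2\vartheta'(t)\frac{\zeta(1/2+it)}{\zeta'(1/2+it)}$ for all real $t$ (the quotient is extended analytically, with value $0$, at points where $\zeta'(\frac12+it)=0$; such points are zeros of $\zeta(\frac12+it)$). *)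

theory Defs
  imports "HOL-Complex_Analysis.Complex_Analysis"
begin

section \<open>The Riemann zeta function\<close>

text \<open>
  The analytic continuation of the Dirichlet series to the plane punctured at \<open>1\<close>. The value at the
  pole is a convention that makes the description unique; well-definedness is
  \<open>ex1_is_riemann_zeta\<close> below.
\<close>

definition is_riemann_zeta :: "(complex \<Rightarrow> complex) \<Rightarrow> bool" where
  "is_riemann_zeta f \<longleftrightarrow>
     f holomorphic_on - {1} \<and> f 1 = 0 \<and>
     (\<forall>s. Re s > 1 \<longrightarrow> (\<lambda>n. of_nat (Suc n) powr (-s)) sums f s)"

definition riemann_zeta :: "complex \<Rightarrow> complex" where
  "riemann_zeta = (THE f. is_riemann_zeta f)"

lemma holomorphic_suminf_powr_bound:
  fixes f :: "nat \<Rightarrow> complex \<Rightarrow> complex" and N :: nat and B :: "complex \<Rightarrow> real"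
  assumes hol: "\<And>n. f n holomorphic_on {s. Re s > 1 - real N}"
    and B: "continuous_on UNIV B"
    and bound: "\<And>n s. Re s > 1 - real N \<Longrightarrow> norm (f n s) \<le> B s * real (Suc n) powr (-(Re s + real N))"
  shows "(\<lambda>s. \<Sum>n. f n s) holomorphic_on {s. Re s > 1 - real N}"
    and "Re s > 1 - real N \<Longrightarrow> summable (\<lambda>n. f n s)"
proof -
  let ?S = "{s. Re s > 1 - real N}"
  have sm: "summable (\<lambda>n. C * real (Suc n) powr (-(a + real N)))" if "a > 1 - real N" for a C
  proof -
    have "summable (\<lambda>n. real n powr (-(a + real N)))"
      using that by (subst summable_real_powr_iff) auto
    hence "summable (\<lambda>n. real (Suc n) powr (-(a + real N)))"
      by (subst summable_Suc_iff)
    thus ?thesis by (rule summable_mult)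
  qed
  show "Re s > 1 - real N \<Longrightarrow> summable (\<lambda>n. f n s)"
    using summable_comparison_test'[OF sm[of "Re s" "B s"], of 0 "\<lambda>n. f n s"] bound[of s] by blast
  show "(\<lambda>s. \<Sum>n. f n s) holomorphic_on ?S"
  proof (rule holomorphic_uniform_sequence[where f = "\<lambda>n s. \<Sum>i<n. f i s"])
    show "open ?S" by (rule open_halfspace_Re_gt)
    show "(\<lambda>s. \<Sum>i<n. f i s) holomorphic_on ?S" for n
      by (intro holomorphic_intros hol)
  next
    fix x assume x: "x \<in> ?S"
    define d where "d = (Re x - (1 - real N)) / 2"
    have d: "d > 0" using x by (simp add: d_def)
    have re: "Re s \<ge> Re x - d" if "s \<in> cball x d" for s
      using that abs_Re_le_cmod[of "x - s"] by (simp add: dist_norm)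
    have sub: "cball x d \<subseteq> ?S"
      using re d by (force simp: d_def field_simps)
    have "bounded (B ` cball x d)"
      by (intro compact_imp_bounded compact_continuous_image continuous_on_subset[OF B]) auto
    then obtain C where C: "\<And>s. s \<in> cball x d \<Longrightarrow> \<bar>B s\<bar> \<le> C"
      unfolding bounded_iff by fastforce
    have "uniform_limit (cball x d) (\<lambda>n s. \<Sum>i<n. f i s) (\<lambda>s. \<Sum>i. f i s) sequentially"
    proof (rule Weierstrass_m_test)
      show "summable (\<lambda>n. C * real (Suc n) powr (-((Re x - d) + real N)))"
        using x by (intro sm) (auto simp: d_def field_simps)
      fix n s assume s: "s \<in> cball x d"
      have "norm (f n s) \<le> B s * real (Suc n) powr (-(Re s + real N))"
        using sub s by (intro bound) auto
      also have "\<dots> \<le> C * real (Suc n) powr (-((Re x - d) + real N))"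
        using C[OF s] re[OF s] by (intro mult_mono powr_mono) auto
      finally show "norm (f n s) \<le> \<dots>" .
    qed
    thus "\<exists>d>0. cball x d \<subseteq> ?S \<and>
        uniform_limit (cball x d) (\<lambda>n s. \<Sum>i<n. f i s) (\<lambda>s. \<Sum>i. f i s) sequentially"
      using d sub by blast
  qed
qed

text \<open>
  For existence, Taylor's formula for \<open>(n + 1) powr (1 - s)\<close> at \<open>n\<close>, summed over \<open>n\<close>, expresses
  \<open>(s - 1) * \<zeta> s\<close> by the values \<open>\<zeta> (s + 1), \<zeta> (s + 2), \<dots>\<close> and a series of remainders that
  converges further to the left. This continues \<open>(s - 1) * \<zeta> s\<close> one strip at a time.
\<close>

definition zeta_ff :: "nat \<Rightarrow> complex \<Rightarrow> complex" where
  "zeta_ff k s = (\<Prod>j<k. 1 - s - of_nat j)"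

definition zeta_rem :: "nat \<Rightarrow> nat \<Rightarrow> complex \<Rightarrow> complex" where
  "zeta_rem N n s = of_nat (Suc (Suc n)) powr (1 - s)
     - (\<Sum>i\<le>N. zeta_ff i s * of_nat (Suc n) powr (1 - s - of_nat i) / fact i)"

lemma zeta_ff_holomorphic [holomorphic_intros]: "zeta_ff k holomorphic_on A"
  unfolding zeta_ff_def[abs_def] by (intro holomorphic_intros)

lemma zeta_rem_holomorphic: "zeta_rem N n holomorphic_on A"
  unfolding zeta_rem_def[abs_def] by (intro holomorphic_intros) auto

lemma zeta_rem_bound:
  assumes s: "Re s > 1 - real N"
  shows "norm (zeta_rem N n s) \<le> norm (zeta_ff (Suc N) s) * real (Suc n) powr (-(Re s + real N))"
proof -
  define w z where "w = (of_nat (Suc n) :: complex)" and "z = (of_nat (Suc (Suc n)) :: complex)"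
  let ?F = "\<lambda>i z. zeta_ff i s * z powr (1 - s - of_nat i)"
  let ?B = "norm (zeta_ff (Suc N) s) * real (Suc n) powr (-(Re s + real N))"
  have seg: "\<exists>u. x = of_real u \<and> u \<ge> real (Suc n)" if "x \<in> closed_segment w z" for x
  proof -
    have "w = of_real (real (Suc n))" "z = of_real (real (Suc (Suc n)))"
      by (simp_all add: w_def z_def)
    hence "x \<in> of_real ` closed_segment (real (Suc n)) (real (Suc (Suc n)))"
      using that by (simp only: closed_segment_of_real)
    thus ?thesis by (auto simp: closed_segment_eq_real_ivl)
  qed
  have "norm (?F 0 z - (\<Sum>i\<le>N. ?F i w * (z - w) ^ i / fact i)) \<le> ?B * norm (z - w) ^ Suc N / fact N"
  proof (rule complex_Taylor[where S = "closed_segment w z"])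
    fix i x assume "x \<in> closed_segment w z"
    then obtain u where u: "x = of_real u" "u \<ge> real (Suc n)" using seg by blast
    have "x \<notin> \<real>\<^sub>\<le>\<^sub>0" using u by (auto simp: complex_nonpos_Reals_iff)
    thus "(?F i has_field_derivative ?F (Suc i) x) (at x within closed_segment w z)"
      by (auto intro!: derivative_eq_intros simp: zeta_ff_def algebra_simps)
  next
    fix x assume "x \<in> closed_segment w z"
    then obtain u where u: "x = of_real u" "u \<ge> real (Suc n)" using seg by blast
    have "norm (x powr (1 - s - of_nat (Suc N))) = u powr (-(Re s + real N))"
      using u by (simp add: norm_powr_real_powr algebra_simps)
    also have "\<dots> \<le> real (Suc n) powr (-(Re s + real N))"
      using u s by (intro powr_mono2') auto
    finally show "norm (?F (Suc N) x) \<le> ?B"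
      by (simp add: norm_mult mult_left_mono del: of_nat_Suc)
  qed auto
  also have "?F 0 z - (\<Sum>i\<le>N. ?F i w * (z - w) ^ i / fact i) = zeta_rem N n s"
    by (simp add: zeta_rem_def w_def z_def zeta_ff_def)
  also have "?B * norm (z - w) ^ Suc N / fact N = ?B / fact N"
    by (simp add: z_def w_def)
  also have "\<dots> \<le> ?B / 1"
    by (intro divide_left_mono) (auto simp: fact_ge_1)
  finally show ?thesis by simp
qed

lemma zeta_continuation_halfplane:
  "\<exists>E. E holomorphic_on {s. Re s > 1 - real m} \<and>
       (\<forall>s. Re s > 1 \<longrightarrow> (\<lambda>n. of_nat (Suc n) powr (-s)) sums (E s / (s - 1)))"
proof (induction m)
  case 0
  let ?f = "\<lambda>n s. of_nat (Suc n) powr (-s) :: complex"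
  have b: "norm (?f n s) \<le> 1 * real (Suc n) powr (-(Re s + real 0))" for n s
    using norm_powr_real_powr[of "of_nat (Suc n)" "-s"] by (simp del: of_nat_Suc)
  have h: "?f n holomorphic_on A" for n A
    by (intro holomorphic_intros)
  have "(\<lambda>s. \<Sum>n. ?f n s) holomorphic_on {s. Re s > 1 - real 0}"
    by (rule holomorphic_suminf_powr_bound(1)[OF h _ b]) (rule continuous_on_const)
  hence "(\<lambda>s. (s - 1) * (\<Sum>n. ?f n s)) holomorphic_on {s. Re s > 1 - real 0}"
    by (intro holomorphic_intros)
  moreover have "(\<lambda>n. ?f n s) sums ((s - 1) * (\<Sum>n. ?f n s) / (s - 1))" if "Re s > 1" for s
  proof -
    have "summable (\<lambda>n. ?f n s)"
      by (rule holomorphic_suminf_powr_bound(2)[OF h _ b]) (use that in auto)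
    moreover have "s \<noteq> 1" using that by auto
    ultimately show ?thesis by (simp add: summable_sums)
  qed
  ultimately show ?case by blast
next
  case (Suc m)
  then obtain E where E: "E holomorphic_on {s. Re s > 1 - real m}"
    and Es: "\<And>s. Re s > 1 \<Longrightarrow> (\<lambda>n. of_nat (Suc n) powr (-s)) sums (E s / (s - 1))" by blast
  define N where "N = Suc m"
  define G where "G = (\<lambda>s. 1 + (\<Sum>n. zeta_rem N n s)
      - (\<Sum>i\<in>{2..N}. zeta_ff (i - 1) s / fact i * E (s + of_nat (i - 1))))"
  have B: "continuous_on UNIV (\<lambda>s. norm (zeta_ff (Suc N) s))"
    by (intro continuous_on_norm holomorphic_on_imp_continuous_on zeta_ff_holomorphic)
  note R = holomorphic_suminf_powr_bound[OF zeta_rem_holomorphic B zeta_rem_bound]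
  have "(\<lambda>s. E (s + of_nat (i - 1))) holomorphic_on {s. Re s > 1 - real N}" if "i \<in> {2..N}" for i
  proof -
    have "(E \<circ> (\<lambda>s. s + of_nat (i - 1))) holomorphic_on {s. Re s > 1 - real N}"
      using that by (intro holomorphic_on_compose_gen[OF _ E] holomorphic_intros) (auto simp: N_def)
    thus ?thesis by (simp add: o_def)
  qed
  hence "G holomorphic_on {s. Re s > 1 - real N}"
    unfolding G_def by (intro holomorphic_intros R(1)) auto
  moreover have "(\<lambda>n. of_nat (Suc n) powr (-s)) sums (G s / (s - 1))" if s: "Re s > 1" for s
  proof -
    have s1: "s \<noteq> 1" using s by auto
    define T where "T = (\<lambda>n. of_nat (Suc n) powr (1 - s) :: complex)"
    have "T \<longlonglongrightarrow> 0"
    proof -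
      have "(\<lambda>n. real n powr (1 - Re s)) \<longlonglongrightarrow> 0"
        using s by (intro tendsto_neg_powr filterlim_real_sequentially) auto
      hence "(\<lambda>n. real (Suc n) powr (1 - Re s)) \<longlonglongrightarrow> 0"
        by (rule LIMSEQ_Suc)
      moreover have "norm (T n) = real (Suc n) powr (1 - Re s)" for n
        using norm_powr_real_powr[of "of_nat (Suc n)" "1-s"] by (simp add: T_def del: of_nat_Suc)
      ultimately show ?thesis by (subst tendsto_norm_zero_iff [symmetric]) simp
    qed
    hence tel: "(\<lambda>n. T (Suc n) - T n) sums (0 - T 0)"
      by (rule telescope_sums)
    have ser: "(\<lambda>n. zeta_ff i s / fact i * of_nat (Suc n) powr (1 - s - of_nat i)) sums
        (zeta_ff i s / fact i * (E (s + of_nat (i - 1)) / (s + of_nat (i - 1) - 1)))"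
      if "i \<ge> 1" for i
    proof -
      have *: "-(s + of_nat (i - 1)) = 1 - s - of_nat i" using that by (simp add: of_nat_diff)
      have "Re (s + of_nat (i - 1)) > 1" using s by simp
      from Es[OF this] show ?thesis unfolding * by (rule sums_mult)
    qed
    have "(\<lambda>n. (T (Suc n) - T n) - (\<Sum>i\<in>{1..N}. zeta_ff i s / fact i * of_nat (Suc n) powr (1 - s - of_nat i)))
       sums ((0 - T 0) - (\<Sum>i\<in>{1..N}. zeta_ff i s / fact i * (E (s + of_nat (i - 1)) / (s + of_nat (i - 1) - 1))))"
      by (intro sums_diff tel sums_sum ser) auto
    also have "(\<lambda>n. (T (Suc n) - T n) - (\<Sum>i\<in>{1..N}. zeta_ff i s / fact i * of_nat (Suc n) powr (1 - s - of_nat i)))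
       = (\<lambda>n. zeta_rem N n s)"
    proof
      fix n
      have "{..N} = insert 0 {1..N}" by auto
      thus "(T (Suc n) - T n) - (\<Sum>i\<in>{1..N}. zeta_ff i s / fact i * of_nat (Suc n) powr (1 - s - of_nat i))
         = zeta_rem N n s"
        by (simp add: zeta_rem_def T_def zeta_ff_def)
    qed
    also have "{1..N} = insert 1 {2..N}" by (auto simp: N_def)
    also have "(\<Sum>i\<in>insert 1 {2..N}. zeta_ff i s / fact i * (E (s + of_nat (i - 1)) / (s + of_nat (i - 1) - 1)))
       = - E s + (\<Sum>i\<in>{2..N}. zeta_ff i s / fact i * (E (s + of_nat (i - 1)) / (s + of_nat (i - 1) - 1)))"
      using s1 by (simp add: zeta_ff_def field_simps)
    also have "(\<Sum>i\<in>{2..N}. zeta_ff i s / fact i * (E (s + of_nat (i - 1)) / (s + of_nat (i - 1) - 1)))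
       = (\<Sum>i\<in>{2..N}. - (zeta_ff (i - 1) s / fact i * E (s + of_nat (i - 1))))"
    proof (rule sum.cong)
      fix i assume i: "i \<in> {2..N}"
      define k where "k = i - 1"
      have k: "i = Suc k" using i by (simp add: k_def)
      have "Re (s + of_nat k - 1) > 0" using s by simp
      hence nz: "s + of_nat k - 1 \<noteq> 0" by (metis less_irrefl zero_complex.sel(1))
      have "zeta_ff i s = - (zeta_ff k s * (s + of_nat k - 1))"
        by (simp add: k zeta_ff_def algebra_simps)
      thus "zeta_ff i s / fact i * (E (s + of_nat (i - 1)) / (s + of_nat (i - 1) - 1))
         = - (zeta_ff (i - 1) s / fact i * E (s + of_nat (i - 1)))"
        unfolding k_def [symmetric] using nz by simp
    qed simp
    finally have "(\<Sum>n. zeta_rem N n s) = -1 + E s + (\<Sum>i\<in>{2..N}. zeta_ff (i - 1) s / fact i * E (s + of_nat (i - 1)))"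
      by (simp add: sums_iff T_def sum_negf)
    hence "G s = E s" by (simp add: G_def)
    thus ?thesis using Es[OF s] by simp
  qed
  ultimately show ?case unfolding N_def by blast
qed

theorem ex1_is_riemann_zeta: "\<exists>!f. is_riemann_zeta f"
proof (rule ex_ex1I)
  let ?H = "\<lambda>m::nat. {s. Re s > 1 - real m}"
  obtain E where E: "\<And>m. E m holomorphic_on ?H m"
    and Es: "\<And>m s. Re s > 1 \<Longrightarrow> (\<lambda>n. of_nat (Suc n) powr (-s)) sums (E m s / (s - 1))"
    using zeta_continuation_halfplane by metis
  have eq: "E k s = E m s" if "k \<le> m" "s \<in> ?H k" for k m s
  proof (rule analytic_continuation_open[of "?H 0" "?H k" "E k" "E m"])
    show "open (?H 0)" "open (?H k)" by (rule open_halfspace_Re_gt)+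
    have "Re 2 > 1 - real 0" by simp
    thus "?H 0 \<noteq> {}" by blast
    show "connected (?H k)" by (intro convex_connected convex_halfspace_Re_gt)
    show "?H 0 \<subseteq> ?H k" by auto
    show "E k holomorphic_on ?H k" by (rule E)
    show "E m holomorphic_on ?H k" by (rule holomorphic_on_subset[OF E]) (use that in auto)
    show "E k z = E m z" if "z \<in> ?H 0" for z
    proof -
      have "Re z > 1" using that by simp
      moreover from this have "z \<noteq> 1" by auto
      ultimately show ?thesis using sums_unique2[OF Es[of z k] Es[of z m]] by simp
    qed
  qed fact
  define J where "J = (\<lambda>s. nat \<lceil>\<bar>Re s\<bar>\<rceil> + 2)"
  define f where "f = (\<lambda>s. E (J s) s / (s - 1))"
  have J: "s \<in> ?H (J s)" for s unfolding J_def by (simp, linarith)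
  have Ef: "E (J s) s = E m s" if "s \<in> ?H m" for s m
  proof (cases "J s \<le> m")
    case True
    thus ?thesis by (rule eq) (rule J)
  next
    case False
    hence "m \<le> J s" by simp
    thus ?thesis using that by (rule eq [symmetric])
  qed
  have "f holomorphic_on - {1}"
  proof -
    have "f field_differentiable at s" if "s \<in> - {1}" for s
    proof -
      have "(\<lambda>s. E (J s) s) holomorphic_on ?H (J s)"
        by (rule holomorphic_transform[OF E[of "J s"]]) (rule Ef [symmetric])
      hence "(\<lambda>s. E (J s) s) field_differentiable at s"
        by (rule holomorphic_on_imp_differentiable_at) (rule open_halfspace_Re_gt, rule J)
      thus ?thesis unfolding f_def using that by (intro derivative_intros field_differentiable_divide) auto
    qed
    thus ?thesis by (auto simp: holomorphic_on_open open_Compl field_differentiable_def)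
  qed
  moreover have "f 1 = 0" by (simp add: f_def)
  ultimately have "is_riemann_zeta f" using Es by (auto simp: is_riemann_zeta_def f_def)
  thus "\<exists>f. is_riemann_zeta f" by blast
next
  fix f g assume f: "is_riemann_zeta f" and g: "is_riemann_zeta g"
  have "f s = g s" for s
  proof (cases "s = 1")
    case False
    show ?thesis
    proof (rule analytic_continuation_open[of "{s. Re s > 1}" "-{1}" f g])
      show "open {s. Re s > 1}" by (rule open_halfspace_Re_gt)
      have "Re 2 > 1" by simp
      thus "{s. Re s > 1} \<noteq> {}" by blast
      show "connected (-{1::complex})" by (rule connected_punctured_universe) simp
      show "f z = g z" if "z \<in> {s. Re s > 1}" for z
        using that f g unfolding is_riemann_zeta_def by (metis mem_Collect_eq sums_unique2)
    qed (use f g False in \<open>auto simp: is_riemann_zeta_def\<close>)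
  qed (use f g in \<open>auto simp: is_riemann_zeta_def\<close>)
  thus "f = g" by blast
qed

lemma is_riemann_zeta_riemann_zeta: "is_riemann_zeta riemann_zeta"
  unfolding riemann_zeta_def by (rule theI'[OF ex1_is_riemann_zeta])


section \<open>Real analytic functions and the Riemann--Siegel theta function\<close>

definition real_analytic :: "(real \<Rightarrow> real) \<Rightarrow> bool" where
  "real_analytic f \<longleftrightarrow> (\<forall>x. \<exists>F. (\<lambda>h. f (x + h)) has_fps_expansion F)"

definition is_rs_theta :: "(real \<Rightarrow> real) \<Rightarrow> bool" where
  "is_rs_theta \<theta> \<longleftrightarrow>
     real_analytic \<theta> \<and> \<theta> 0 = 0 \<and>
     (\<forall>t. Gamma (Complex (1/4) (t/2)) =
          of_real (cmod (Gamma (Complex (1/4) (t/2)))) * exp (\<i> * of_real (\<theta> t + t/2 * ln pi)))"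

definition rs_theta :: "real \<Rightarrow> real" where
  "rs_theta = (THE \<theta>. is_rs_theta \<theta>)"

lemma real_analytic_imp_continuous:
  assumes "real_analytic f"
  shows "continuous_on A f"
proof -
  have "isCont f x" for x
  proof -
    obtain F where "(\<lambda>h. f (x + h)) has_fps_expansion F"
      using assms by (auto simp: real_analytic_def)
    hence "isCont (\<lambda>h. f (x + h)) 0" by (rule has_fps_expansion_imp_continuous)
    thus ?thesis by (simp add: isCont_iff)
  qed
  thus ?thesis by (simp add: continuous_at_imp_continuous_on)
qed

lemma integer_valued_continuous_eq_0:
  fixes d :: "real \<Rightarrow> real"
  assumes cont: "continuous_on UNIV d" and int: "\<And>t. d t \<in> \<int>" and "d 0 = 0"
  shows "d t = 0"
proof -
  have "d constant_on UNIV"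
  proof (rule continuous_discrete_range_constant[OF connected_UNIV cont])
    fix x :: real
    have "1 \<le> norm (d y - d x)" if "d y \<noteq> d x" for y
      using that int[of x] int[of y] by (auto elim!: Ints_cases simp flip: of_int_diff of_int_abs)
    thus "\<exists>e>0. \<forall>y. y \<in> UNIV \<and> d y \<noteq> d x \<longrightarrow> e \<le> norm (d y - d x)"
      by (intro exI[of _ 1]) auto
  qed
  thus ?thesis using \<open>d 0 = 0\<close> by (auto simp: constant_on_def)
qed

lemma real_analytic_Im:
  assumes "\<And>x. g analytic_on {complex_of_real x}"
  shows "real_analytic (\<lambda>x. Im (g (of_real x)))"
  unfolding real_analytic_def
proof
  fix x :: real
  obtain F where "(\<lambda>h. g (of_real x + h)) has_fps_expansion F"
    using analytic_at_imp_has_fps_expansion[OF assms] by blast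
  hence "eventually (\<lambda>h. (\<lambda>n. fps_nth F n * h ^ n) sums g (of_real x + h)) (nhds 0)"
  proof -
    assume F: "(\<lambda>h. g (of_real x + h)) has_fps_expansion F"
    hence "eventually (\<lambda>h. h \<in> eball 0 (fps_conv_radius F)) (nhds 0)"
      by (intro eventually_nhds_in_open) (auto simp: has_fps_expansion_def zero_ereal_def)
    moreover have "eventually (\<lambda>h. eval_fps F h = g (of_real x + h)) (nhds 0)"
      using F by (simp add: has_fps_expansion_def)
    ultimately show ?thesis
      by eventually_elim (metis in_eball_iff dist_0_norm sums_eval_fps)
  qed
  hence "eventually (\<lambda>u::real. (\<lambda>n. fps_nth F n * of_real u ^ n) sums g (of_real x + of_real u)) (nhds 0)"
  proof (rule eventually_compose_filterlim)
    show "filterlim complex_of_real (nhds 0) (nhds 0)"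
      using tendsto_of_real[OF filterlim_ident[of "nhds (0::real)"], where 'a = complex] by simp
  qed
  hence "eventually (\<lambda>u. (\<lambda>n. fps_nth (Abs_fps (\<lambda>n. Im (fps_nth F n))) n * u ^ n)
           sums Im (g (of_real (x + u)))) (nhds 0)"
    by eventually_elim (drule sums_Im, simp flip: of_real_power)
  thus "\<exists>F. (\<lambda>h. Im (g (of_real (x + h)))) has_fps_expansion F"
    by (intro exI) (rule has_fps_expansionI)
qed

theorem ex1_is_rs_theta: "\<exists>!\<theta>. is_rs_theta \<theta>"
proof (rule ex_ex1I)
  define L where "L = ln pi"
  define g where "g = (\<lambda>z. ln_Gamma (1/4 + \<i> * z / 2) - \<i> * z / 2 * of_real L)"
  define \<theta> where "\<theta> = (\<lambda>t. Im (g (of_real t)))"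
  have c: "1/4 + \<i> * of_real t / 2 = Complex (1/4) (t/2)" for t
    by (simp add: complex_eq_iff)
  have "real_analytic \<theta>"
    unfolding \<theta>_def
  proof (rule real_analytic_Im)
    show "g analytic_on {complex_of_real x}" for x
      unfolding g_def by (auto intro!: analytic_intros simp: c complex_nonpos_Reals_iff)
  qed
  moreover have "\<theta> 0 = 0"
    using ln_Gamma_complex_of_real[of "1/4"] by (simp add: \<theta>_def g_def)
  moreover have "Gamma (Complex (1/4) (t/2)) =
      of_real (cmod (Gamma (Complex (1/4) (t/2)))) * exp (\<i> * of_real (\<theta> t + t/2 * ln pi))" for t
  proof -
    let ?w = "Complex (1/4) (t/2)"
    have "?w \<notin> \<int>\<^sub>\<le>\<^sub>0" by (auto elim!: nonpos_Ints_cases simp: complex_eq_iff)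
    hence G: "Gamma ?w = exp (ln_Gamma ?w)" by (simp add: Gamma_complex_altdef)
    have "\<theta> t + t/2 * ln pi = Im (ln_Gamma ?w)"
      by (simp add: \<theta>_def g_def c flip: L_def)
    thus ?thesis
      unfolding G norm_exp_eq_Re using exp_eq_polar[of "ln_Gamma ?w"] by (simp only: cis_conv_exp)
  qed
  ultimately show "\<exists>\<theta>. is_rs_theta \<theta>" unfolding is_rs_theta_def by blast
next
  fix \<theta> \<theta>' assume 1: "is_rs_theta \<theta>" and 2: "is_rs_theta \<theta>'"
  have "(\<theta> t - \<theta>' t) / (2 * pi) = 0" for t
  proof (rule integer_valued_continuous_eq_0[where d = "\<lambda>t. (\<theta> t - \<theta>' t) / (2 * pi)"])
    show "continuous_on UNIV (\<lambda>t. (\<theta> t - \<theta>' t) / (2 * pi))"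
      using 1 2 by (intro continuous_intros real_analytic_imp_continuous) (auto simp: is_rs_theta_def)
    show "(\<theta> 0 - \<theta>' 0) / (2 * pi) = 0" using 1 2 by (simp add: is_rs_theta_def)
    fix t
    have "Complex (1/4) (t/2) \<notin> \<int>\<^sub>\<le>\<^sub>0" by (auto elim!: nonpos_Ints_cases simp: complex_eq_iff)
    hence "Gamma (Complex (1/4) (t/2)) \<noteq> 0" by (simp add: Gamma_eq_zero_iff)
    hence "exp (\<i> * of_real (\<theta> t + t/2 * ln pi)) = exp (\<i> * of_real (\<theta>' t + t/2 * ln pi))"
      using 1 2 unfolding is_rs_theta_def by (metis mult_cancel_left norm_eq_zero of_real_eq_0_iff)
    then obtain n :: int where "\<i> * of_real (\<theta> t + t/2 * ln pi) =
        \<i> * of_real (\<theta>' t + t/2 * ln pi) + of_int (2 * n) * of_real pi * \<i>"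
      by (auto simp: exp_eq)
    hence "\<theta> t - \<theta>' t = 2 * real_of_int n * pi"
      by (simp add: complex_eq_iff)
    thus "(\<theta> t - \<theta>' t) / (2 * pi) \<in> \<int>" by simp
  qed
  thus "\<theta> = \<theta>'" by (auto simp: fun_eq_iff)
qed

lemma is_rs_theta_rs_theta: "is_rs_theta rs_theta"
  unfolding rs_theta_def by (rule theI'[OF ex1_is_rs_theta])


section \<open>The function kappa\<close>
text \<open>
  Points of the critical line where the derivative of zeta vanishes are zeros of zeta, and the
  analytic extension of the quotient takes the value \<open>0\<close> there.
\<close>

definition zeta_quotient :: "real \<Rightarrow> complex" where
  "zeta_quotient t =
     (if deriv riemann_zeta (Complex (1/2) t) = 0 then 0
      else riemann_zeta (Complex (1/2) t) / deriv riemann_zeta (Complex (1/2) t))"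

definition is_kappa :: "(real \<Rightarrow> real) \<Rightarrow> bool" where
  "is_kappa \<kappa> \<longleftrightarrow>
     real_analytic \<kappa> \<and> \<kappa> 0 = - 1/2 \<and>
     (\<forall>t. exp (2 * of_real pi * \<i> * of_real (\<kappa> t)) =
          1 + 2 * of_real (deriv rs_theta t) * zeta_quotient t)"

lemma is_kappa_unique:
  assumes "is_kappa \<kappa>" "is_kappa \<kappa>'"
  shows "\<kappa> = \<kappa>'"
proof -
  have "\<kappa> t - \<kappa>' t = 0" for t
  proof (rule integer_valued_continuous_eq_0[where d = "\<lambda>t. \<kappa> t - \<kappa>' t"])
    show "continuous_on UNIV (\<lambda>t. \<kappa> t - \<kappa>' t)"
      using assms by (intro continuous_intros real_analytic_imp_continuous) (auto simp: is_kappa_def)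
    show "\<kappa> 0 - \<kappa>' 0 = 0" using assms by (simp add: is_kappa_def)
    fix t
    have "exp (2 * of_real pi * \<i> * of_real (\<kappa> t)) = exp (2 * of_real pi * \<i> * of_real (\<kappa>' t))"
      using assms by (simp add: is_kappa_def)
    then obtain n :: int where "2 * of_real pi * \<i> * of_real (\<kappa> t) =
        2 * of_real pi * \<i> * of_real (\<kappa>' t) + of_int (2 * n) * of_real pi * \<i>"
      by (auto simp: exp_eq)
    hence "pi * (\<kappa> t - \<kappa>' t) = pi * real_of_int n"
      by (simp add: complex_eq_iff algebra_simps)
    hence "\<kappa> t - \<kappa>' t = real_of_int n" by simp
    thus "\<kappa> t - \<kappa>' t \<in> \<int>" by simp
  qed
  thus ?thesis by (auto simp: fun_eq_iff)
qed

end

theory Submission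
  imports Defs
begin

text \<open>
  At a zero \<open>\<rho>\<close> of order \<open>\<omega>\<close> the quotient \<open>\<zeta> / \<zeta>'\<close> vanishes and has derivative \<open>1 / \<omega>\<close>.
  The imaginary part of the equation for \<open>\<kappa>\<close> is
  \<open>sin (2 \<pi> \<kappa> t) = 2 \<theta>' t Im (\<zeta> / \<zeta>') (1/2 + i t)\<close>. At a zero of \<open>\<zeta>\<close> its left side has
  derivative \<open>2 \<pi> \<kappa>'\<close>, and its right side has derivative \<open>2 \<theta>' / \<omega>\<close>.
\<close>

text \<open>Caratheodory's slope function of \<open>f\<close> at \<open>z\<close>, multiplied by
  \<open>h\<close>, is a slope function of the product, because \<open>f z = 0\<close>. Thus
  \<open>h\<close> need not be differentiable.\<close>

lemma DERIV_mult_isCont_at_zero: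
  fixes f h :: "'a :: real_normed_field \<Rightarrow> 'a"
  assumes f: "(f has_field_derivative D) (at z)" "f z = 0" and h: "isCont h z"
  shows "((\<lambda>w. f w * h w) has_field_derivative D * h z) (at z)"
proof -
  obtain p where p: "\<And>w. f w = p w * (w - z)" "isCont p z" "p z = D"
    using f by (auto simp: CARAT_DERIV)
  have "\<forall>w. f w * h w - f z * h z = (p w * h w) * (w - z)" "isCont (\<lambda>w. p w * h w) z"
    using p(2) h by (auto intro!: continuous_intros simp: f(2) p(1))
  thus ?thesis unfolding CARAT_DERIV using p(3) by (intro exI[of _ "\<lambda>w. p w * h w"]) auto
qed

text \<open>At points where \<open>deriv f\<close> vanishes, in particular at multiple zeros, the quotient is \<open>x / 0 = 0\<close>.\<close>

lemma DERIV_quotient_deriv_at_zero: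
  fixes f :: "complex \<Rightarrow> complex"
  assumes f: "f holomorphic_on S" "open S" "connected S" "z \<in> S" "\<exists>w\<in>S. f w \<noteq> 0"
    and z: "f z = 0" "zorder f z = int n"
  shows "n > 0" and "((\<lambda>w. f w / deriv f w) has_field_derivative 1 / of_nat n) (at z)"
proof -
  define g where "g = zor_poly f z"
  obtain r where n: "n > 0" and r: "r > 0" "g holomorphic_on ball z r"
    and fg: "\<And>w. w \<in> ball z r \<Longrightarrow> f w = g w * (w - z) ^ n \<and> g w \<noteq> 0"
  proof -
    from zorder_exist_zero[OF f] z obtain r where "n > 0" "r > 0" "g holomorphic_on cball z r"
      "\<And>w. w \<in> cball z r \<Longrightarrow> f w = g w * (w - z) ^ n \<and> g w \<noteq> 0"
      unfolding g_def by auto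
    thus ?thesis using that by (meson ball_subset_cball holomorphic_on_subset subsetD)
  qed
  show "n > 0" by fact
  obtain m where m: "n = Suc m" using n by (cases n) auto
  \<comment> \<open>Writing \<open>f w\<close> as \<open>g w * (w - z) ^ n\<close> and cancelling
    \<open>(w - z) ^ m\<close> in \<open>f w / deriv f w\<close> leaves
    \<open>(w - z) * u w\<close>.\<close>
  define u where "u = (\<lambda>w. g w / (of_nat n * g w + (w - z) * deriv g w))"
  have g0: "g z \<noteq> 0" using fg[of z] r(1) by simp
  have "isCont g z" "isCont (deriv g) z"
    using r by (auto intro!: continuous_on_interior[of "ball z r"]
        holomorphic_on_imp_continuous_on holomorphic_deriv)
  hence "isCont u z" unfolding u_def
    using g0 n by (intro continuous_intros) auto
  hence "((\<lambda>w. (w - z) * u w) has_field_derivative 1 * u z) (at z)"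
    by (intro DERIV_mult_isCont_at_zero) (auto intro!: derivative_eq_intros)
  moreover have "u z = 1 / of_nat n" using g0 by (simp add: u_def)
  \<comment> \<open>This holds on the whole ball: at \<open>z\<close> both sides are 0 since
    \<open>f z = 0\<close>, and at any other zero of the denominator of \<open>u\<close> also
    \<open>deriv f w = 0\<close>, so both divisions give 0.\<close>
  moreover have "(w - z) * u w = f w / deriv f w" if w: "w \<in> ball z r" for w
  proof (cases "w = z")
    case True
    thus ?thesis by (simp add: z)
  next
    case False
    have "(g has_field_derivative deriv g w) (at w)"
      using r w by (intro holomorphic_derivI[of g "ball z r"]) auto
    moreover have "((\<lambda>w. (w - z) ^ n) has_field_derivative of_nat n * (w - z) ^ m) (at w)"
      unfolding m by (rule DERIV_cong[OF DERIV_power]) (auto intro!: derivative_eq_intros)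
    ultimately have "((\<lambda>w. g w * (w - z) ^ n) has_field_derivative
        (w - z) ^ m * (of_nat n * g w + (w - z) * deriv g w)) (at w)"
      by (auto dest: DERIV_mult simp: m algebra_simps)
    hence "(f has_field_derivative (w - z) ^ m * (of_nat n * g w + (w - z) * deriv g w)) (at w)"
      by (rule has_field_derivative_transform_within_open[of _ _ _ "ball z r"])
         (use w fg in auto)
    hence "deriv f w = (w - z) ^ m * (of_nat n * g w + (w - z) * deriv g w)"
      by (rule DERIV_imp_deriv)
    moreover have "f w = (w - z) ^ m * ((w - z) * g w)"
      using fg[OF w] by (simp add: m)
    ultimately show ?thesis using False by (simp add: u_def)
  qed
  ultimately show "((\<lambda>w. f w / deriv f w) has_field_derivative 1 / of_nat n) (at z)"
    using has_field_derivative_transform_within_open[of "\<lambda>w. (w - z) * u w" _ z "ball z r"] r(1)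
    by simp
qed

lemma has_fps_expansion_imp_eventually_DERIV:
  fixes f :: "'a :: {banach, real_normed_field} \<Rightarrow> 'a"
  assumes "f has_fps_expansion F"
  shows "eventually (\<lambda>z. (f has_field_derivative eval_fps (fps_deriv F) z) (at z)) (nhds 0)"
proof -
  have "eventually (\<lambda>z. z \<in> eball 0 (fps_conv_radius F)) (nhds 0)"
    using assms by (intro eventually_nhds_in_open) (auto simp: has_fps_expansion_def zero_ereal_def)
  \<comment> \<open>Agreement with the series at \<open>z\<close> alone would not transfer the
    derivative; it is needed near every \<open>z\<close> close to 0.\<close>
  moreover have "eventually (\<lambda>z. eventually (\<lambda>w. f w = eval_fps F w) (nhds z)) (nhds 0)"
    using assms by (simp add: has_fps_expansion_def eventually_eventually eq_commute)
  ultimately show ?thesis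
  proof eventually_elim
    case (elim z)
    have "(eval_fps F has_field_derivative eval_fps (fps_deriv F) z) (at z)"
      using elim(1) by (intro has_field_derivative_eval_fps) (auto simp: in_eball_iff)
    thus ?case
      using DERIV_cong_ev[OF refl elim(2) refl] by blast
  qed
qed

text \<open>Near \<open>x\<close> the derivative is the sum of the differentiated series, which is
  continuous inside its disc of convergence. The first part serves \<open>\<kappa>\<close>, the
  second the factor \<open>deriv rs_theta\<close>.\<close>

lemma real_analytic_deriv:
  assumes "real_analytic f"
  shows "(f has_field_derivative deriv f x) (at x)" and "isCont (deriv f) x"
proof -
  obtain F where F: "(\<lambda>h. f (x + h)) has_fps_expansion F"
    using assms by (auto simp: real_analytic_def)
  have ev: "eventually (\<lambda>h. (f has_field_derivative eval_fps (fps_deriv F) h) (at (x + h))) (nhds 0)"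
    using has_fps_expansion_imp_eventually_DERIV[OF F]
    by eventually_elim (use DERIV_shift[of f _ _ x] in \<open>simp add: add.commute\<close>)
  show "(f has_field_derivative deriv f x) (at x)"
    using eventually_nhds_x_imp_x[OF ev] by (simp add: DERIV_imp_deriv)
  have "isCont (eval_fps (fps_deriv F)) 0"
    using F fps_conv_radius_deriv[of F]
    by (intro continuous_eval_fps) (auto simp: has_fps_expansion_def zero_ereal_def)
  moreover have "eventually (\<lambda>h. deriv f (x + h) = eval_fps (fps_deriv F) h) (nhds 0)"
    using ev by eventually_elim (rule DERIV_imp_deriv)
  ultimately have "isCont (\<lambda>h. deriv f (x + h)) 0"
    by (subst isCont_cong)
  thus "isCont (deriv f) x" by (simp add: isCont_iff)
qed

text \<open>The Basel sum provides a point where zeta is nonzero, so that its zeros have finite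
  order.\<close>

lemma riemann_zeta_2: "riemann_zeta 2 = of_real (pi\<^sup>2 / 6)"
proof (rule sums_unique2)
  show "(\<lambda>n. of_nat (Suc n) powr (-2)) sums riemann_zeta 2"
    using is_riemann_zeta_riemann_zeta by (simp add: is_riemann_zeta_def del: of_nat_Suc)
  have "(of_nat (Suc n) :: complex) powr (-2) = of_real (1 / (real n + 1)\<^sup>2)" for n
    using powr_nat'[of "of_nat (Suc n)" 2]
    by (simp add: powr_minus_divide add.commute)
  thus "(\<lambda>n. (of_nat (Suc n) :: complex) powr (-2)) sums of_real (pi\<^sup>2 / 6)"
    using sums_of_real[OF inverse_squares_sums, where 'a = complex] by (simp add: add.commute)
qed

theorem proposition41:
  fixes \<kappa> :: "real \<Rightarrow> real" and \<xi> :: real and \<omega> :: nat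
  assumes "is_kappa \<kappa>"
    and "riemann_zeta (Complex (1/2) \<xi>) = 0"
    and "zorder riemann_zeta (Complex (1/2) \<xi>) = int \<omega>"
  shows "deriv \<kappa> \<xi> = 1 / (pi * real \<omega>) * deriv rs_theta \<xi>"
proof -
  let ?q = "\<lambda>w. riemann_zeta w / deriv riemann_zeta w"
  let ?c = "\<lambda>t. Complex (1/2) t"
  have hol: "riemann_zeta holomorphic_on - {1}"
    using is_riemann_zeta_riemann_zeta by (simp add: is_riemann_zeta_def)
  have op: "open (- {1 :: complex})"
    by (rule open_Compl) simp
  have conn: "connected (- {1 :: complex})"
    by (rule connected_punctured_universe) simp
  have mem: "?c \<xi> \<in> - {1}" by (simp add: complex_eq_iff)
  have nz: "\<exists>w\<in>- {1}. riemann_zeta w \<noteq> 0"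
    by (intro bexI[of _ 2]) (auto simp: riemann_zeta_2)
  note zero = DERIV_quotient_deriv_at_zero[OF hol op conn mem nz assms(2,3)]
  \<comment> \<open>Along the critical line the chain rule multiplies the real number
    \<open>1 / \<omega>\<close> by \<open>\<i>\<close>, so the imaginary part retains the whole
    derivative.\<close>
  have "(?c has_vector_derivative \<i>) (at \<xi>)"
    by (auto intro!: derivative_eq_intros simp: Complex_eq)
  hence "(?q \<circ> ?c has_vector_derivative \<i> * (1 / of_nat \<omega>)) (at \<xi>)"
    by (rule field_vector_diff_chain_at) (use zero(2) in auto)
  hence "((\<lambda>t. Im (?q (?c t))) has_vector_derivative Im (\<i> * (1 / of_nat \<omega>))) (at \<xi>)"
    using bounded_linear.has_vector_derivative[OF bounded_linear_Im] by (fastforce simp: o_def)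
  \<comment> \<open>The case distinction in \<open>zeta_quotient\<close> agrees with division by
    zero giving 0.\<close>
  moreover have "zeta_quotient t = ?q (?c t)" for t
    by (simp add: zeta_quotient_def)
  ultimately have q: "((\<lambda>t. Im (zeta_quotient t)) has_field_derivative 1 / real \<omega>) (at \<xi>)"
    by (simp add: has_real_derivative_iff_has_vector_derivative Im_divide_of_nat)
  have q0: "zeta_quotient \<xi> = 0"
    by (simp add: zeta_quotient_def assms(2))

  have \<kappa>: "cis (2 * pi * \<kappa> t) = 1 + 2 * of_real (deriv rs_theta t) * zeta_quotient t" for t
    using assms(1) by (simp add: is_kappa_def cis_conv_exp mult_ac)
  have sin: "sin (2 * pi * \<kappa> t) = Im (zeta_quotient t) * (2 * deriv rs_theta t)" for t
    using arg_cong[OF \<kappa>[of t], of Im] by simp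
  \<comment> \<open>This makes the cosine factor from differentiating the sine at
    \<open>\<xi>\<close> equal to 1.\<close>
  have cos: "cos (2 * pi * \<kappa> \<xi>) = 1"
    using arg_cong[OF \<kappa>[of \<xi>], of Re] q0 by simp

  \<comment> \<open>Continuity suffices here, as the other factor vanishes at \<open>\<xi>\<close>;
    no second derivative of theta enters.\<close>
  have "isCont (deriv rs_theta) \<xi>"
    using is_rs_theta_rs_theta by (simp add: is_rs_theta_def real_analytic_deriv)
  hence "((\<lambda>t. Im (zeta_quotient t) * (2 * deriv rs_theta t)) has_field_derivative
      1 / real \<omega> * (2 * deriv rs_theta \<xi>)) (at \<xi>)"
    using q q0 by (intro DERIV_mult_isCont_at_zero continuous_intros) auto
  moreover have "(\<kappa> has_field_derivative deriv \<kappa> \<xi>) (at \<xi>)"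
    using assms(1) by (simp add: is_kappa_def real_analytic_deriv)
  hence "((\<lambda>t. sin (2 * pi * \<kappa> t)) has_field_derivative 2 * pi * deriv \<kappa> \<xi>) (at \<xi>)"
    by (auto intro!: derivative_eq_intros simp: cos)
  ultimately have "2 * pi * deriv \<kappa> \<xi> = 1 / real \<omega> * (2 * deriv rs_theta \<xi>)"
    unfolding sin by (rule DERIV_unique[rotated])
  thus ?thesis using zero(1) by (simp add: field_simps)
qed

end
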